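(* Let $E$ be a Banach lattice with the positive Schur property. Then every demi Dunford–Pettis operator (hence every Dunford–Pettis operator) $T:E\to E$ is uo-demi Dunford–Pettis.
   Context: All Banach lattices are real; "operator" means bounded linear map. A Banach lattice $E$ has the positive Schur property if every weakly null sequence with positive terms in $E$ is norm null. A net $(x_\alpha)$ in a Banach lattice $E$ is uo-convergent (unbounded order convergent) to $x$ if $|x_\alpha-x|\wedge y$ converges in order to $0$ for every $y\in E^+$. An operator $T:E\to E$ on a Banach lattice $E$ is uo-demi Dunford–Pettis (unbounded order demi Dunford–Pettis) if for every weakly null sequence $(x_n)$ in $E$ such that $(x_n-T(x_n))$ is uo-convergent to $0$, one has $\|x_n\|\to0$. An operator $T:X\to X$ on a Banach space $X$ is demi Dunford–Pettis if for every weakly null sequence $(x_n)$ in $X$ with $\|x_n-T(x_n)\|\to0$, one has $\|x_n\|\to0$. An operator is Dunford–Pettis if it maps weakly null sequences to norm null sequences. *)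

theory Defs
  imports "HOL-Analysis.Analysis" "HOL-Library.Lattice_Algebras"
begin

text \<open>Real Banach lattices; the modulus is \<open>\<bar>x\<bar> = sup x (- x)\<close>, and no unit element or
  Dedekind completeness is assumed.\<close>

class banach_lattice = banach + ordered_real_vector + lattice_ab_group_add_abs +
  assumes norm_lattice: "\<bar>x\<bar> \<le> \<bar>y\<bar> \<Longrightarrow> norm x \<le> norm y"

definition weakly_null :: "(nat \<Rightarrow> 'a::real_normed_vector) \<Rightarrow> bool" where
  "weakly_null x \<longleftrightarrow> (\<forall>f :: 'a \<Rightarrow> real. bounded_linear f \<longrightarrow> (\<lambda>n. f (x n)) \<longlonglongrightarrow> 0)"

definition positive_Schur_property :: "'a::banach_lattice itself \<Rightarrow> bool" where
  "positive_Schur_property _ \<longleftrightarrow>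
     (\<forall>x :: nat \<Rightarrow> 'a. weakly_null x \<longrightarrow> (\<forall>n. 0 \<le> x n) \<longrightarrow> (\<lambda>n. norm (x n)) \<longlonglongrightarrow> 0)"

text \<open>A set \<open>D\<close> satisfies \<open>decreases_to_zero D\<close> iff it is the range of a decreasing net with
  infimum \<open>0\<close> (a downward directed set is a decreasing net indexed by itself).\<close>

definition decreases_to_zero :: "'a::banach_lattice set \<Rightarrow> bool" where
  "decreases_to_zero D \<longleftrightarrow>
     D \<noteq> {} \<and> (\<forall>a\<in>D. \<forall>b\<in>D. \<exists>c\<in>D. c \<le> a \<and> c \<le> b) \<and>
     (\<forall>d\<in>D. 0 \<le> d) \<and> (\<forall>z. (\<forall>d\<in>D. z \<le> d) \<longrightarrow> z \<le> 0)"

text \<open>Nets are rendered as functions along a filter. The dominating net \<open>y\<^sub>\<beta> \<down> 0\<close> may have an index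
  set different from that of the given net: for every \<open>\<beta>\<close>, \<open>\<bar>x\<^sub>\<alpha> - l\<bar> \<le> y\<^sub>\<beta>\<close> holds eventually
  in \<open>\<alpha>\<close>.\<close>

definition order_convergent_to ::
    "('i \<Rightarrow> 'a::banach_lattice) \<Rightarrow> 'a \<Rightarrow> 'i filter \<Rightarrow> bool" where
  "order_convergent_to x l F \<longleftrightarrow>
     (\<exists>D. decreases_to_zero D \<and> (\<forall>d\<in>D. \<forall>\<^sub>F i in F. \<bar>x i - l\<bar> \<le> d))"

definition uo_convergent_to ::
    "('i \<Rightarrow> 'a::banach_lattice) \<Rightarrow> 'a \<Rightarrow> 'i filter \<Rightarrow> bool" where
  "uo_convergent_to x l F \<longleftrightarrow>
     (\<forall>y\<ge>0. order_convergent_to (\<lambda>i. inf \<bar>x i - l\<bar> y) 0 F)"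

definition Dunford_Pettis :: "('a::banach \<Rightarrow> 'b::banach) \<Rightarrow> bool" where
  "Dunford_Pettis T \<longleftrightarrow> bounded_linear T \<and>
     (\<forall>x. weakly_null x \<longrightarrow> (\<lambda>n. norm (T (x n))) \<longlonglongrightarrow> 0)"

definition demi_Dunford_Pettis :: "('a::banach \<Rightarrow> 'a) \<Rightarrow> bool" where
  "demi_Dunford_Pettis T \<longleftrightarrow> bounded_linear T \<and>
     (\<forall>x. weakly_null x \<longrightarrow> (\<lambda>n. norm (x n - T (x n))) \<longlonglongrightarrow> 0 \<longrightarrow>
        (\<lambda>n. norm (x n)) \<longlonglongrightarrow> 0)"

definition uo_demi_Dunford_Pettis :: "('a::banach_lattice \<Rightarrow> 'a) \<Rightarrow> bool" where
  "uo_demi_Dunford_Pettis T \<longleftrightarrow> bounded_linear T \<and>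
     (\<forall>x. weakly_null x \<longrightarrow> uo_convergent_to (\<lambda>n. x n - T (x n)) 0 sequentially \<longrightarrow>
        (\<lambda>n. norm (x n)) \<longlonglongrightarrow> 0)"

end

theory Submission
  imports Defs
begin

text \<open>It suffices that a weakly null and uo-null sequence \<open>z\<close> is norm null, for then a demi
  Dunford--Pettis \<open>T\<close> can be applied to \<open>z = x - T x\<close>. The positive Schur property makes
  the norm order continuous, so \<open>\<bar>z\<^sub>n\<bar> \<sqinter> u\<close> is norm null for every \<open>u \<ge> 0\<close>. If \<open>z\<close> is not norm null,
  a rescaled subsequence \<open>v\<close> is almost disjoint in the sense of Kadec and Pelczynski: small
  truncations turn \<open>v\<^sub>k\<^sup>+\<close> and \<open>v\<^sub>k\<^sup>-\<close> into \<open>a\<^sub>k\<close> and \<open>b\<^sub>k\<close> such that every \<open>a\<^sub>k\<close> is disjoint from every \<open>b\<^sub>j\<close>.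
  For a bounded functional \<open>f\<close>, the supremum of \<open>f\<close> over the elements of \<open>[0, x]\<close> disjoint from all
  \<open>b\<^sub>j\<close> extends to a bounded functional \<open>g\<close> with \<open>g b\<^sub>j = 0\<close> and \<open>g a\<^sub>k \<ge> f a\<^sub>k\<close>. Since \<open>g v\<^sub>k\<close> tends to
  \<open>0\<close>, this for \<open>f\<close> and \<open>- f\<close> forces \<open>f v\<^sub>k\<^sup>+\<close> to tend to \<open>0\<close>. Thus \<open>v\<^sup>+\<close>, and likewise \<open>v\<^sup>-\<close>, is weakly null, hence norm
  null, a contradiction.\<close>

section \<open>Closedness of the positive cone, truncations and disjointness\<close>

lemma norm_mono_nonneg:
  fixes x y :: "'a::banach_lattice"
  assumes "0 \<le> x" "x \<le> y"
  shows "norm x \<le> norm y"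
  using norm_lattice[of x y] assms by (simp add: abs_of_nonneg order_trans[OF assms])

lemma norm_modulus: "norm \<bar>x :: 'a::banach_lattice\<bar> = norm x"
  by (intro antisym norm_lattice) auto

text \<open>Since \<open>X n\<close> is nonnegative, \<open>\<bar>nprt l\<bar>\<close> is at most
  \<open>\<bar>X n - l\<bar>\<close>, whose norm tends to 0; so the negative part of
  \<open>l\<close> vanishes.\<close>

lemma tendsto_nonneg_lattice:
  fixes l :: "'a::banach_lattice"
  assumes "X \<longlonglongrightarrow> l" "\<And>n. 0 \<le> X n"
  shows "0 \<le> l"
proof -
  have "norm (nprt l) \<le> norm (X n - l)" for n
  proof (rule norm_lattice)
    have "- \<bar>X n - l\<bar> \<le> X n - \<bar>X n - l\<bar>" using assms(2) by simp
    also have "\<dots> \<le> l" using abs_ge_self[of "X n - l"] by (simp add: algebra_simps)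
    finally have "- \<bar>X n - l\<bar> \<le> nprt l" by (simp add: nprt_def)
    then show "\<bar>nprt l\<bar> \<le> \<bar>X n - l\<bar>"
      using nprt_le_zero[of l] by (simp add: abs_of_nonpos minus_le_iff)
  qed
  moreover have "(\<lambda>n. norm (X n - l)) \<longlonglongrightarrow> 0"
    by (intro tendsto_norm_zero LIM_zero assms(1))
  ultimately have "norm (nprt l) \<le> 0"
    by (intro LIMSEQ_le_const) auto
  then show ?thesis by (simp only: zero_le_iff_zero_nprt norm_le_zero_iff)
qed

lemma tendsto_le_lattice:
  fixes l m :: "'a::banach_lattice"
  assumes "X \<longlonglongrightarrow> l" "Y \<longlonglongrightarrow> m" "\<And>n. X n \<le> Y n"
  shows "l \<le> m"
  using tendsto_nonneg_lattice[OF tendsto_diff[OF assms(2,1)]] assms(3) by simp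

text \<open>The left side lies below both \<open>x + inf y u\<close> and \<open>u + inf y u\<close>,
  and the infimum of these two is the right side.\<close>

lemma inf_add_le:
  fixes x y u :: "'a::banach_lattice"
  assumes "0 \<le> x" "0 \<le> y" "0 \<le> u"
  shows "inf (x + y) u \<le> inf x u + inf y u"
proof -
  have "inf (x + y) u \<le> x + inf y u"
    using assms by (metis add.commute add_increasing add_inf_distrib_left inf_mono order_refl)
  moreover have "inf (x + y) u \<le> u + inf y u"
    using assms by (meson add_increasing2 inf_greatest inf_le2 order_trans)
  ultimately show ?thesis
    by (simp add: add_inf_distrib_right)
qed

lemma inf_pprt_nprt: "inf (pprt x) (pprt (- x)) = (0 :: 'a::banach_lattice)"
proof -
  have "pprt x = x + - nprt x" using prts[of x] by (simp add: eq_diff_eq)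
  then have "inf (pprt x) (pprt (- x)) = inf (x + - nprt x) (0 + - nprt x)"
    by (simp add: pprt_neg)
  also have "\<dots> = inf x 0 + - nprt x" by (simp only: add_inf_distrib_right)
  also have "\<dots> = 0" by (simp only: nprt_def add.right_inverse)
  finally show ?thesis .
qed

lemma diff_pprt_diff: "x - pprt (x - s) = inf x (s :: 'a::banach_lattice)"
  by (simp add: pprt_def diff_sup_eq_inf add_inf_distrib_left inf_commute)

lemma abs_scaleR_le:
  fixes x :: "'a::banach_lattice"
  assumes "0 \<le> c" "c \<le> 1"
  shows "\<bar>c *\<^sub>R x\<bar> \<le> \<bar>x\<bar>"
proof (rule abs_leI)
  have *: "c *\<^sub>R y \<le> \<bar>y\<bar>" for y :: 'a
    using scaleR_left_mono[OF abs_ge_self[of y] assms(1)] scaleR_right_mono[OF assms(2), of "\<bar>y\<bar>"]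
    by simp
  show "c *\<^sub>R x \<le> \<bar>x\<bar>" "- (c *\<^sub>R x) \<le> \<bar>x\<bar>" using *[of x] *[of "- x"] by simp_all
qed

text \<open>Compare both truncations with \<open>d\<close>, the difference of \<open>x\<close> and
  \<open>M\<close> times \<open>y\<close>. The first lies below the positive part of
  \<open>d\<close> because \<open>s\<close> exceeds \<open>M\<close> times \<open>y\<close>. The
  second lies below the negative part of \<open>d\<close>, because \<open>y\<close> minus
  \<open>x\<close> over \<open>M\<close> is \<open>- d\<close> over \<open>M\<close> and
  \<open>M\<close> is at least 1. Positive and negative parts of \<open>d\<close> are
  disjoint.\<close>

lemma pprt_truncations_disjoint:
  fixes x y :: "'a::banach_lattice"
  assumes M: "1 \<le> M" and s: "M *\<^sub>R y \<le> s" and t: "x /\<^sub>R M \<le> t"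
  shows "inf (pprt (x - s)) (pprt (y - t)) = 0"
proof (rule antisym)
  define d where "d = x - M *\<^sub>R y"
  have "y - x /\<^sub>R M = inverse M *\<^sub>R (- d)"
    using M by (simp add: d_def algebra_simps)
  also have "\<dots> \<le> inverse M *\<^sub>R pprt (- d)"
    using M by (intro scaleR_left_mono) (auto simp: pprt_def)
  also have "\<dots> \<le> pprt (- d)"
    using M scaleR_right_mono[of "inverse M" 1 "pprt (- d)"] by (simp add: inverse_le_1_iff)
  finally have "y - x /\<^sub>R M \<le> pprt (- d)" .
  with t have "pprt (y - t) \<le> pprt (- d)"
    unfolding pprt_def[of "y - t"] by (intro sup_least) (auto intro: order_trans[OF diff_left_mono])
  moreover have "pprt (x - s) \<le> pprt d" using s by (intro pprt_mono) (simp add: d_def)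
  ultimately show "inf (pprt (x - s)) (pprt (y - t)) \<le> 0"
    using inf_mono inf_pprt_nprt[of d] by metis
qed simp

lemma term_le_suminf:
  fixes h :: "nat \<Rightarrow> 'a::banach_lattice"
  assumes "summable h" "\<And>i. 0 \<le> h i"
  shows "h m \<le> suminf h"
proof (rule tendsto_le_lattice[OF tendsto_const])
  \<comment> \<open>The shift by \<open>Suc m\<close> puts \<open>h m\<close> into every partial
    sum, so the comparison holds for all \<open>n\<close> and not just eventually.\<close>
  show "(\<lambda>n. \<Sum>i<n + Suc m. h i) \<longlonglongrightarrow> suminf h"
    by (rule LIMSEQ_ignore_initial_segment[OF summable_LIMSEQ[OF assms(1)]])
  show "h m \<le> (\<Sum>i<n + Suc m. h i)" for n
  proof -
    have "(\<Sum>i<n + Suc m. h i) = h m + (\<Sum>i\<in>{..<n + Suc m} - {m}. h i)"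
      by (intro sum.remove) auto
    then show ?thesis using assms(2) by (simp add: sum_nonneg)
  qed
qed

section \<open>Bounded functionals from additive maps on the positive cone\<close>

text \<open>Allows functionals on the cone to be built from additivity and a norm bound, with no
  separate check of homogeneity.\<close>

lemma additive_bounded_imp_bounded_linear:
  fixes g :: "'a::real_normed_vector \<Rightarrow> real"
  assumes add: "\<And>x y. g (x + y) = g x + g y" and bd: "\<And>x. \<bar>g x\<bar> \<le> K * norm x"
  shows "bounded_linear g"
proof
  fix t :: real and x :: 'a
  \<comment> \<open>The additive function \<open>h\<close> has period \<open>1\<close>, so it is bounded on the whole line and therefore zero.\<close>
  define h where "h s = g (s *\<^sub>R x) - s * g x" for s
  have hadd: "h (s + u) = h s + h u" for s u
    by (simp add: h_def add scaleR_add_left algebra_simps)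
  then interpret h: Modules.additive h by unfold_locales
  have hnat: "h (of_nat n * s) = of_nat n * h s" for n s
    by (induction n) (auto simp: hadd h.zero algebra_simps)
  have h1: "h 1 = 0" by (simp add: h_def)
  then have hnat1: "h (of_nat n) = 0" for n
    using hnat[of n 1] by simp
  have hint: "h (of_int i) = 0" for i
    by (cases i rule: int_cases2) (simp_all add: hnat1 h.minus)
  define B where "B = \<bar>K\<bar> * norm x + \<bar>g x\<bar>"
  have B: "\<bar>h s\<bar> \<le> B" for s
  proof -
    have "h s = h (frac s)"
      using hadd[of "of_int \<lfloor>s\<rfloor>" "frac s"] hint by (simp add: frac_def)
    moreover have "\<bar>g (frac s *\<^sub>R x)\<bar> \<le> \<bar>K\<bar> * norm x"
    proof -
      have "\<bar>g (frac s *\<^sub>R x)\<bar> \<le> \<bar>K\<bar> * (frac s * norm x)"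
        using bd[of "frac s *\<^sub>R x"] mult_right_mono[OF abs_ge_self[of K], of "frac s * norm x"] by simp
      also have "\<dots> \<le> \<bar>K\<bar> * (1 * norm x)"
        by (intro mult_left_mono mult_right_mono) (auto simp: less_imp_le[OF frac_lt_1])
      finally show ?thesis by simp
    qed
    moreover have "\<bar>frac s * g x\<bar> \<le> 1 * \<bar>g x\<bar>"
      unfolding abs_mult by (intro mult_right_mono) (auto simp: less_imp_le[OF frac_lt_1])
    ultimately show ?thesis unfolding B_def h_def by linarith
  qed
  have "h t = 0"
  proof (rule ccontr)
    assume "h t \<noteq> 0"
    then obtain n :: nat where "B < of_nat n * \<bar>h t\<bar>"
      using reals_Archimedean3[of "\<bar>h t\<bar>"] by auto
    with B[of "of_nat n * t"] hnat[of n t] show False by (simp add: abs_mult)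
  qed
  then show "g (t *\<^sub>R x) = t *\<^sub>R g x" by (simp add: h_def)
qed (use assms in \<open>auto simp: mult.commute intro!: exI[of _ K]\<close>)

text \<open>The extension is the value of \<open>p\<close> at the positive part minus its value at
  the negative part. The bound survives with the same \<open>K\<close> because the two values add up
  to \<open>p \<bar>x\<bar>\<close>.\<close>

lemma cone_additive_extends:
  fixes p :: "'a::banach_lattice \<Rightarrow> real"
  assumes add: "\<And>x y. 0 \<le> x \<Longrightarrow> 0 \<le> y \<Longrightarrow> p (x + y) = p x + p y"
    and nonneg: "\<And>x. 0 \<le> x \<Longrightarrow> 0 \<le> p x"
    and bd: "\<And>x. 0 \<le> x \<Longrightarrow> p x \<le> K * norm x"
  obtains g where "bounded_linear g" "\<And>x. 0 \<le> x \<Longrightarrow> g x = p x"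
proof
  define g where "g x = p (pprt x) - p (- nprt x)" for x
  \<comment> \<open>The value does not depend on how \<open>x\<close> is written as a difference of
    positive elements; additivity of \<open>g\<close> follows by adding up decompositions.\<close>
  have diff: "p u - p v = g x" if "0 \<le> u" "0 \<le> v" "x = u - v" for u v x
  proof -
    have "u + - nprt x = pprt x + v"
    proof -
      have "u = (pprt x + nprt x) + v" using prts[of x] that(3) by simp
      then show ?thesis by simp
    qed
    then have "p u + p (- nprt x) = p (pprt x) + p v"
      using that add by (metis neg_0_le_iff_le nprt_le_zero zero_le_pprt)
    then show ?thesis by (simp add: g_def)
  qed
  have p0: "p 0 = 0" using add[of 0 0] by simp
  show "g x = p x" if "0 \<le> x" for x using diff[of x 0 x] that p0 by simp
  show "bounded_linear g"
  proof (rule additive_bounded_imp_bounded_linear[where K = "K"])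
    fix x y :: 'a
    have "x + y = (pprt x + pprt y) - (- nprt x + - nprt y)"
    proof -
      have "x + y = (pprt x + nprt x) + (pprt y + nprt y)" using prts[of x] prts[of y] by simp
      also have "\<dots> = (pprt x + pprt y) - (- nprt x + - nprt y)" by (simp add: algebra_simps)
      finally show ?thesis .
    qed
    then have "g (x + y) = p (pprt x + pprt y) - p (- nprt x + - nprt y)"
      by (intro diff[symmetric] add_nonneg_nonneg) simp_all
    also have "p (pprt x + pprt y) = p (pprt x) + p (pprt y)" by (rule add) simp_all
    also have "p (- nprt x + - nprt y) = p (- nprt x) + p (- nprt y)" by (rule add) simp_all
    finally show "g (x + y) = g x + g y" by (simp add: g_def)
  next
    fix x
    have "p (pprt x) + p (- nprt x) = p \<bar>x\<bar>"
      by (simp add: abs_prts add[symmetric])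
    also have "\<dots> \<le> K * norm x" using bd[of "\<bar>x\<bar>"] by (simp add: norm_modulus)
    finally show "\<bar>g x\<bar> \<le> K * norm x"
      using nonneg[of "pprt x"] nonneg[of "- nprt x"] by (auto simp: g_def)
  qed
qed

text \<open>This is the Riesz-Kantorovich formula for the positive part of \<open>f\<close>, with
  the competitors restricted to \<open>S\<close>. Subadditivity on the cone comes from splitting
  \<open>z\<close> below \<open>x + y\<close> into \<open>inf z x\<close> and
  \<open>z - inf z x\<close>, both in \<open>S\<close> by solidity; superadditivity comes from
  closure of \<open>S\<close> under sums.\<close>

lemma solid_sup_functional:
  fixes f :: "'a::banach_lattice \<Rightarrow> real" and S :: "'a set"
  assumes f: "bounded_linear f" and K: "\<And>x. \<bar>f x\<bar> \<le> K * norm x" "0 \<le> K"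
    and zero: "0 \<in> S" and pos: "\<And>y. y \<in> S \<Longrightarrow> 0 \<le> y"
    and add: "\<And>x y. x \<in> S \<Longrightarrow> y \<in> S \<Longrightarrow> x + y \<in> S"
    and solid: "\<And>x y. y \<in> S \<Longrightarrow> 0 \<le> x \<Longrightarrow> x \<le> y \<Longrightarrow> x \<in> S"
  obtains g where "bounded_linear g" "\<And>x. 0 \<le> x \<Longrightarrow> g x = (SUP y\<in>{y\<in>S. y \<le> x}. f y)"
    "\<And>x. 0 \<le> x \<Longrightarrow> 0 \<le> g x" "\<And>x. 0 \<le> x \<Longrightarrow> g x \<le> K * norm x"
    "\<And>y. y \<in> S \<Longrightarrow> f y \<le> g y"
proof -
  interpret f: bounded_linear f by fact
  define p where "p x = (SUP y\<in>{y\<in>S. y \<le> x}. f y)" for x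
  have bd: "f y \<le> K * norm x" if "y \<in> S" "y \<le> x" for x y
  proof -
    have "f y \<le> K * norm y" using K(1)[of y] by linarith
    also have "\<dots> \<le> K * norm x" using that pos K(2) by (intro mult_left_mono norm_mono_nonneg) auto
    finally show ?thesis .
  qed
  have up: "f y \<le> p x" if "y \<in> S" "y \<le> x" for x y
    unfolding p_def using that bd by (intro cSUP_upper bdd_aboveI2[where M = "K * norm x"]) auto
  have least: "p x \<le> M" if "0 \<le> x" "\<And>y. y \<in> S \<Longrightarrow> y \<le> x \<Longrightarrow> f y \<le> M" for x M
    unfolding p_def using that zero by (intro cSUP_least) auto
  have padd: "p (x + y) = p x + p y" if xy: "0 \<le> x" "0 \<le> y" for x y
  proof (rule antisym)
    show "p (x + y) \<le> p x + p y"
    proof (rule least)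
      fix z assume z: "z \<in> S" "z \<le> x + y"
      have "z - inf z x \<le> y"
        using z(2) xy(2) by (simp add: diff_inf_eq_sup add_sup_distrib_left diff_le_eq add.commute)
      moreover have "0 \<le> inf z x" "inf z x \<le> z" using pos z(1) xy by auto
      then have "inf z x \<in> S" "z - inf z x \<in> S"
        by (auto intro: solid[OF z(1)] simp del: diff_inf_eq_sup)
      ultimately have "f (inf z x) + f (z - inf z x) \<le> p x + p y"
        by (intro add_mono up) auto
      then show "f z \<le> p x + p y" by (simp add: f.diff del: diff_inf_eq_sup)
    qed (use xy in auto)
    have "p x \<le> p (x + y) - p y"
    proof (rule least[OF xy(1)])
      fix u assume u: "u \<in> S" "u \<le> x"
      have "p y \<le> p (x + y) - f u"
      proof (rule least[OF xy(2)])
        fix v assume v: "v \<in> S" "v \<le> y"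
        have "f (u + v) \<le> p (x + y)" using u v by (intro up add add_mono)
        then show "f v \<le> p (x + y) - f u" by (simp add: f.add)
      qed
      then show "f u \<le> p (x + y) - p y" by simp
    qed
    then show "p x + p y \<le> p (x + y)" by simp
  qed
  have p0: "0 \<le> p x" if "0 \<le> x" for x using up[OF zero that] by (simp add: f.zero)
  have pK: "p x \<le> K * norm x" if "0 \<le> x" for x using least[OF that bd] .
  obtain g where g: "bounded_linear g" "\<And>x. 0 \<le> x \<Longrightarrow> g x = p x"
    using cone_additive_extends[OF padd p0 pK] by metis
  show ?thesis
    by (rule that[OF g(1)]) (use g(2) p0 pK up pos in \<open>auto simp: p_def\<close>)
qed

section \<open>Almost disjoint sequences and their positive parts\<close>

text \<open>The hypothesis \<open>small\<close> makes each term nearly disjoint from a large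
  multiple of the sum of its predecessors. After truncation the disjointness is exact, so a
  functional can ignore the negative parts while still dominating \<open>f\<close> on the positive
  ones.\<close>

lemma weakly_null_pprt:
  fixes v :: "nat \<Rightarrow> 'a::banach_lattice"
  assumes v: "weakly_null v" and le1: "\<And>n. norm (v n) \<le> 1"
    and small: "(\<lambda>k. norm (inf \<bar>v k\<bar> (4 ^ k *\<^sub>R (\<Sum>i<k. \<bar>v i\<bar>)))) \<longlonglongrightarrow> 0"
  shows "weakly_null (\<lambda>n. pprt (v n))"
proof -
  define h where "h i = (1/2) ^ i *\<^sub>R \<bar>v i\<bar>" for i
  have h0: "0 \<le> h i" for i by (simp add: h_def scaleR_nonneg_nonneg)
  have hs: "summable h"
  proof (rule summable_comparison_test')
    show "summable (\<lambda>i. (1/2 :: real) ^ i)" by (simp add: summable_geometric)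
    show "norm (h i) \<le> (1/2) ^ i" for i
      using mult_left_mono[OF le1[of i], of "(1/2) ^ i"] by (simp add: h_def norm_modulus)
  qed
  \<comment> \<open>The level \<open>s k\<close> serves two purposes: its first summand dominates
    \<open>4 ^ k\<close> times every earlier modulus, and \<open>r k\<close> dominates
    \<open>\<bar>v j\<bar>\<close> divided by \<open>4 ^ j\<close> for every later \<open>j\<close>.
    Of the two factors \<open>2 ^ j\<close> in \<open>4 ^ j\<close>, one makes \<open>h\<close>
    summable and the other lets \<open>r\<close> tend to 0.\<close>
  define r where "r k = (1/2) ^ k *\<^sub>R suminf h" for k
  define s where "s k = 4 ^ k *\<^sub>R (\<Sum>i<k. \<bar>v i\<bar>) + r k" for k
  \<comment> \<open>Bounds the norm of what truncation at \<open>s k\<close> removes from either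
    part of \<open>v k\<close>.\<close>
  define e where "e k = norm (inf \<bar>v k\<bar> (4 ^ k *\<^sub>R (\<Sum>i<k. \<bar>v i\<bar>))) + norm (r k)" for k
  have S0: "0 \<le> suminf h" using order_trans[OF h0 term_le_suminf[OF hs h0]] .
  have r0: "0 \<le> r k" for k using S0 by (simp add: r_def scaleR_nonneg_nonneg)
  have sum0: "0 \<le> 4 ^ k *\<^sub>R (\<Sum>i<k. \<bar>v i\<bar>)" for k by (intro scaleR_nonneg_nonneg sum_nonneg) auto
  have s0: "0 \<le> s k" for k using r0 sum0 by (simp add: s_def)
  have e: "e \<longlonglongrightarrow> 0"
  proof -
    have "(\<lambda>k. (1/2) ^ k * norm (suminf h)) \<longlonglongrightarrow> 0"
      by (intro tendsto_mult_left_zero LIMSEQ_power_zero) simp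
    then have "(\<lambda>k. norm (r k)) \<longlonglongrightarrow> 0" by (simp add: r_def)
    from tendsto_add[OF small this] show ?thesis by (simp add: e_def[abs_def])
  qed
  have inf_e: "norm (inf x (s k)) \<le> e k" if "0 \<le> x" "x \<le> \<bar>v k\<bar>" for x k
  proof -
    have "inf x (s k) \<le> inf \<bar>v k\<bar> (s k)" using that(2) by (simp add: le_infI1)
    also have "\<dots> \<le> inf \<bar>v k\<bar> (4 ^ k *\<^sub>R (\<Sum>i<k. \<bar>v i\<bar>)) + inf \<bar>v k\<bar> (r k)"
      using inf_add_le[OF sum0[of k] r0[of k], of "\<bar>v k\<bar>"] by (simp add: s_def inf_commute)
    also have "\<dots> \<le> inf \<bar>v k\<bar> (4 ^ k *\<^sub>R (\<Sum>i<k. \<bar>v i\<bar>)) + r k" by simp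
    finally have "norm (inf x (s k)) \<le> norm (inf \<bar>v k\<bar> (4 ^ k *\<^sub>R (\<Sum>i<k. \<bar>v i\<bar>)) + r k)"
      using that s0 by (intro norm_mono_nonneg) auto
    then show ?thesis unfolding e_def using norm_triangle_ineq order_trans by blast
  qed
  have s_ge1: "4 ^ k *\<^sub>R x \<le> s k" if "j < k" "x \<le> \<bar>v j\<bar>" for j k x
  proof -
    have "(\<Sum>i<k. \<bar>v i\<bar>) = \<bar>v j\<bar> + (\<Sum>i\<in>{..<k} - {j}. \<bar>v i\<bar>)"
      using that(1) by (intro sum.remove) auto
    then have "\<bar>v j\<bar> \<le> (\<Sum>i<k. \<bar>v i\<bar>)" by (simp add: sum_nonneg)
    with that(2) have "4 ^ k *\<^sub>R x \<le> 4 ^ k *\<^sub>R (\<Sum>i<k. \<bar>v i\<bar>)"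
      by (intro scaleR_left_mono) auto
    then show ?thesis using r0[of k] unfolding s_def by (metis add.right_neutral add_mono)
  qed
  have s_ge2: "x /\<^sub>R 4 ^ k \<le> s j" if "j < k" "x \<le> \<bar>v k\<bar>" for j k x
  proof -
    have "x /\<^sub>R 4 ^ k \<le> \<bar>v k\<bar> /\<^sub>R 4 ^ k" using that(2) by (intro scaleR_left_mono) auto
    also have "\<dots> = (1/2) ^ k *\<^sub>R h k"
    proof -
      have "inverse (4 ^ k) = (1/2 :: real) ^ k * (1/2) ^ k"
        by (simp add: power_mult_distrib[symmetric] power_one_over inverse_eq_divide)
      then show ?thesis by (simp add: h_def)
    qed
    also have "\<dots> \<le> (1/2) ^ k *\<^sub>R suminf h"
      by (intro scaleR_left_mono term_le_suminf hs h0) auto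
    also have "\<dots> \<le> r j" unfolding r_def
      using that(1) S0 by (intro scaleR_right_mono power_decreasing) auto
    also have "\<dots> \<le> s j" using sum0[of j] by (simp add: s_def)
    finally show ?thesis .
  qed
  define a where "a k = pprt (pprt (v k) - s k)" for k
  define b where "b k = pprt (pprt (- v k) - s k)" for k
  have pprt_le: "pprt (v k) \<le> \<bar>v k\<bar>" "pprt (- v k) \<le> \<bar>v k\<bar>" for k
    by (auto simp: pprt_def abs_ge_self abs_ge_minus_self)
  have trunc_le: "a k \<le> pprt (v k)" "b k \<le> pprt (- v k)" for k
    using s0 by (auto simp: a_def b_def pprt_def[of "_ - _"] diff_le_eq)
  \<comment> \<open>For equal indices the positive and negative parts of \<open>v k\<close> are
    already disjoint; otherwise the larger index supplies the factor \<open>M\<close>.\<close>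
  have disj: "inf (a k) (b j) = 0" for k j
  proof (cases k j rule: linorder_cases)
    case equal
    have "inf (a k) (b k) \<le> inf (pprt (v k)) (pprt (- v k))" using trunc_le by (rule inf_mono)
    then have "inf (a k) (b k) \<le> 0" by (simp only: inf_pprt_nprt)
    then show ?thesis using equal by (intro antisym) (auto simp: a_def b_def)
  next
    case less
    then have "inf (b j) (a k) = 0" unfolding a_def b_def
      by (intro pprt_truncations_disjoint[where M = "4 ^ j"] s_ge1[of k] s_ge2[of k] pprt_le) auto
    then show ?thesis by (simp add: inf_commute)
  next
    case greater
    then show ?thesis unfolding a_def b_def
      by (intro pprt_truncations_disjoint[where M = "4 ^ k"] s_ge1[of j] s_ge2[of j] pprt_le) auto
  qed
  \<comment> \<open>The positive cone of the disjoint complement of all \<open>b j\<close>; it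
    contains every \<open>a k\<close>.\<close>
  define S where "S = {y. 0 \<le> y \<and> (\<forall>j. inf y (b j) = 0)}"
  have b0: "0 \<le> b j" for j by (simp add: b_def)
  \<comment> \<open>Upper bounds suffice: those for \<open>f\<close> and for \<open>- f\<close>
    together squeeze \<open>f (pprt (v k))\<close> to 0.\<close>
  have upper: "\<exists>U. U \<longlonglongrightarrow> 0 \<and> (\<forall>k. f (pprt (v k)) \<le> U k)" if f: "bounded_linear f" for f :: "'a \<Rightarrow> real"
  proof -
    interpret f: bounded_linear f by fact
    obtain K where K: "0 \<le> K" "\<And>x. \<bar>f x\<bar> \<le> K * norm x"
      using f.nonneg_bounded by (auto simp: mult.commute)
    have S_pos: "0 \<le> y" if "y \<in> S" for y using that by (simp add: S_def)
    have S_add: "x + y \<in> S" if "x \<in> S" "y \<in> S" for x y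
    proof -
      have "inf (x + y) (b j) \<le> 0" for j
        using inf_add_le[of x y "b j"] that b0[of j] by (simp add: S_def)
      then show ?thesis using that b0 by (auto simp: S_def intro!: antisym)
    qed
    have S_solid: "x \<in> S" if "y \<in> S" "0 \<le> x" "x \<le> y" for x y
    proof -
      have "inf x (b j) \<le> 0" for j
      proof -
        have "inf x (b j) \<le> inf y (b j)" using that(3) by (rule inf_mono) simp
        also have "\<dots> = 0" using that(1) by (simp add: S_def)
        finally show ?thesis .
      qed
      then show ?thesis using that b0 by (auto simp: S_def intro!: antisym)
    qed
    have S0: "0 \<in> S" using b0 by (simp add: S_def inf_absorb1)
    obtain g where g: "bounded_linear g" "\<And>x. 0 \<le> x \<Longrightarrow> g x = (SUP y\<in>{y\<in>S. y \<le> x}. f y)"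
      and g0: "\<And>x. 0 \<le> x \<Longrightarrow> 0 \<le> g x" and gK: "\<And>x. 0 \<le> x \<Longrightarrow> g x \<le> K * norm x"
      and gf: "\<And>y. y \<in> S \<Longrightarrow> f y \<le> g y"
      by (rule solid_sup_functional[of f K S])
        (rule f, rule K(2), rule K(1), rule S0, erule S_pos, erule (1) S_add, erule (2) S_solid, rule that)
    interpret g: bounded_linear g by fact
    \<comment> \<open>An element \<open>y\<close> of \<open>S\<close> below \<open>b j\<close>
      equals \<open>inf y (b j)\<close>, which is 0, so the supremum runs over 0 alone.\<close>
    have gb: "g (b j) = 0" for j
    proof -
      have "y = 0" if "y \<in> S" "y \<le> b j" for y
        using that(1) inf_absorb1[OF that(2)] by (simp add: S_def)
      then have "{y\<in>S. y \<le> b j} = {0}" using S0 b0 by auto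
      then show ?thesis using g(2)[OF b0] by (simp add: f.zero)
    qed
    have "f (pprt (v k)) \<le> g (v k) + 2 * K * e k" for k
    proof -
      define p where "p = inf (pprt (v k)) (s k)"
      define q where "q = inf (pprt (- v k)) (s k)"
      have pq: "pprt (v k) = a k + p" "pprt (- v k) = b k + q"
        unfolding a_def b_def p_def q_def diff_pprt_diff[symmetric] by simp_all
      have "0 \<le> p" "0 \<le> q" using s0 by (auto simp: p_def q_def)
      have pe: "K * norm p \<le> K * e k" and qe: "K * norm q \<le> K * e k"
        unfolding p_def q_def using K(1) pprt_le by (auto intro!: mult_left_mono inf_e)
      have "v k = pprt (v k) - pprt (- v k)" using prts[of "v k"] by (simp add: pprt_neg)
      then have "g (v k) = g (a k) + g p - g q"
        by (simp add: pq g.add g.diff gb)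
      moreover have "a k \<in> S" using disj by (simp add: S_def a_def)
      then have "f (a k) \<le> g (a k)" by (rule gf)
      moreover have "0 \<le> g p" "g q \<le> K * norm q" using g0 gK \<open>0 \<le> p\<close> \<open>0 \<le> q\<close> by auto
      moreover have "f p \<le> K * norm p" using K(2)[of p] by linarith
      ultimately show ?thesis using pe qe by (simp add: pq f.add)
    qed
    moreover have "(\<lambda>k. g (v k) + 2 * K * e k) \<longlonglongrightarrow> 0"
      using v g(1) e unfolding weakly_null_def
      by (intro tendsto_add_zero tendsto_mult_right_zero) auto
    ultimately show ?thesis by blast
  qed
  show ?thesis unfolding weakly_null_def
  proof (intro allI impI)
    fix f :: "'a \<Rightarrow> real" assume f: "bounded_linear f"
    obtain U where U: "U \<longlonglongrightarrow> 0" "\<And>k. f (pprt (v k)) \<le> U k" using upper[OF f] by blast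
    obtain L where L: "L \<longlonglongrightarrow> 0" "\<And>k. - f (pprt (v k)) \<le> L k"
      using upper[OF bounded_linear_minus[OF f]] by blast
    have "- L k \<le> f (pprt (v k))" for k using L(2)[of k] by simp
    from tendsto_sandwich[OF always_eventually[OF allI[OF this]] always_eventually[OF allI[OF U(2)]] _ U(1)]
    show "(\<lambda>n. f (pprt (v n))) \<longlonglongrightarrow> 0" using tendsto_minus[OF L(1)] by simp
  qed
qed

text \<open>A gliding hump: once the first terms are chosen, the multiple of their sum is a fixed
  positive element, so \<open>un\<close> makes all sufficiently late terms nearly disjoint from it,
  and \<open>P\<close> holds at some of these.\<close>

lemma unbounded_norm_null_subsequence:
  fixes y :: "nat \<Rightarrow> 'a::banach_lattice"
  assumes un: "\<And>u. 0 \<le> u \<Longrightarrow> (\<lambda>n. norm (inf \<bar>y n\<bar> u)) \<longlonglongrightarrow> 0"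
    and freq: "\<exists>\<^sub>F n in sequentially. P n"
  obtains r where "strict_mono r" "\<And>k. P (r k)"
    "(\<lambda>k. norm (inf \<bar>y (r k)\<bar> (4 ^ k *\<^sub>R (\<Sum>i<k. \<bar>y (r i)\<bar>)))) \<longlonglongrightarrow> 0"
proof -
  have ex: "\<exists>n>m. P n \<and> norm (inf \<bar>y n\<bar> (4 ^ k *\<^sub>R u)) < (1/2) ^ k" if "0 \<le> u" for m k u
  proof -
    have "\<forall>\<^sub>F n in sequentially. norm (inf \<bar>y n\<bar> (4 ^ k *\<^sub>R u)) < (1/2) ^ k \<and> m < n"
      using that
      by (intro eventually_conj order_tendstoD(2)[OF un] scaleR_nonneg_nonneg eventually_gt_at_top) auto
    from frequently_ex[OF frequently_eventually_conj[OF freq this]] show ?thesis by blast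
  qed
  \<comment> \<open>A state pairs the chosen index with the sum of the moduli chosen before it, so
    that each choice depends on the previous state only.\<close>
  define Q where "Q k x \<longleftrightarrow> P (fst x) \<and> 0 \<le> snd x \<and>
      norm (inf \<bar>y (fst x)\<bar> (4 ^ k *\<^sub>R snd x)) < (1/2) ^ k" for k and x :: "nat \<times> 'a"
  \<comment> \<open>The clause guarded by \<open>k = 0\<close> encodes the initial value of the
    running sum as part of the invariant.\<close>
  have "\<exists>x. \<forall>k. (Q k (x k) \<and> (k = 0 \<longrightarrow> snd (x k) = 0)) \<and>
      (fst (x k) < fst (x (Suc k)) \<and> snd (x (Suc k)) = snd (x k) + \<bar>y (fst (x k))\<bar>)"
  proof (rule dependent_nat_choice)
    show "\<exists>x. Q 0 x \<and> (0 = (0::nat) \<longrightarrow> snd x = 0)"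
      using ex[of 0 0 0] by (auto simp: Q_def)
  next
    fix x k assume "Q k x \<and> (k = 0 \<longrightarrow> snd x = 0)"
    then have "0 \<le> snd x + \<bar>y (fst x)\<bar>" by (simp add: Q_def)
    from ex[OF this, of "fst x" "Suc k"] this
    show "\<exists>x'. (Q (Suc k) x' \<and> (Suc k = 0 \<longrightarrow> snd x' = 0)) \<and>
       fst x < fst x' \<and> snd x' = snd x + \<bar>y (fst x)\<bar>"
      by (auto simp: Q_def)
  qed
  then obtain x where x: "\<And>k. Q k (x k)" "snd (x 0) = 0" "\<And>k. fst (x k) < fst (x (Suc k))"
    "\<And>k. snd (x (Suc k)) = snd (x k) + \<bar>y (fst (x k))\<bar>" by metis
  have sum: "snd (x k) = (\<Sum>i<k. \<bar>y (fst (x i))\<bar>)" for k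
    by (induction k) (simp_all add: x)
  show ?thesis
  proof
    show "strict_mono (\<lambda>k. fst (x k))" by (simp add: strict_mono_Suc_iff x)
    show "P (fst (x k))" for k using x(1) by (simp add: Q_def)
    have bd: "norm (norm (inf \<bar>y (fst (x k))\<bar> (4 ^ k *\<^sub>R (\<Sum>i<k. \<bar>y (fst (x i))\<bar>)))) \<le> (1/2) ^ k" for k
      using x(1)[of k] by (simp add: Q_def sum)
    have "(\<lambda>k. (1/2 :: real) ^ k) \<longlonglongrightarrow> 0" by (rule LIMSEQ_power_zero) simp
    then show "(\<lambda>k. norm (inf \<bar>y (fst (x k))\<bar> (4 ^ k *\<^sub>R (\<Sum>i<k. \<bar>y (fst (x i))\<bar>)))) \<longlonglongrightarrow> 0"
      by (rule Lim_null_comparison[OF always_eventually[OF allI[OF bd]]])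
  qed
qed

lemma weakly_null_un_null_imp_norm_null:
  fixes z :: "nat \<Rightarrow> 'a::banach_lattice"
  assumes psp: "positive_Schur_property TYPE('a)" and z: "weakly_null z"
    and un: "\<And>u. 0 \<le> u \<Longrightarrow> (\<lambda>n. norm (inf \<bar>z n\<bar> u)) \<longlonglongrightarrow> 0"
  shows "(\<lambda>n. norm (z n)) \<longlonglongrightarrow> 0"
proof (rule ccontr)
  assume "\<not> (\<lambda>n. norm (z n)) \<longlonglongrightarrow> 0"
  then obtain \<epsilon> where "0 < \<epsilon>" and freq0: "\<exists>\<^sub>F n in sequentially. \<epsilon> \<le> norm (z n)"
    by (auto simp: tendsto_iff not_eventually not_less)
  \<comment> \<open>Rescaling avoids the uniform boundedness of weakly null sequences, which needs Hahn--Banach.\<close>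
  define c where "c n = inverse (max 1 (norm (z n)))" for n
  have c: "0 \<le> c n" "c n \<le> 1" for n by (auto simp: c_def inverse_le_1_iff)
  define y where "y n = c n *\<^sub>R z n" for n
  have y_le: "\<bar>y n\<bar> \<le> \<bar>z n\<bar>" for n unfolding y_def by (rule abs_scaleR_le[OF c])
  have y1: "norm (y n) \<le> 1" for n
    by (auto simp: y_def c_def field_simps max_def)
  \<comment> \<open>Rescaling keeps vectors of norm at most 1 and normalizes longer ones to norm
    1.\<close>
  have y_large: "min \<epsilon> 1 \<le> norm (y n)" if "\<epsilon> \<le> norm (z n)" for n
    using that by (auto simp: y_def c_def field_simps max_def)
  have wn: "weakly_null y" unfolding weakly_null_def
  proof (intro allI impI)
    fix f :: "'a \<Rightarrow> real" assume f: "bounded_linear f"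
    have "norm (f (y n)) \<le> norm (f (z n))" for n
      using mult_right_mono[OF c(2)[of n], of "\<bar>f (z n)\<bar>"] c(1)[of n]
      by (simp add: y_def linear_simps(5)[OF f] abs_mult)
    moreover have "(\<lambda>n. norm (f (z n))) \<longlonglongrightarrow> 0" 
      using z f unfolding weakly_null_def by (intro tendsto_norm_zero) blast
    ultimately show "(\<lambda>n. f (y n)) \<longlonglongrightarrow> 0" by (rule Lim_null_comparison[OF always_eventually[OF allI]])
  qed
  have un_y: "(\<lambda>n. norm (inf \<bar>y n\<bar> u)) \<longlonglongrightarrow> 0" if "0 \<le> u" for u
  proof (rule Lim_null_comparison[OF _ un[OF that]])
    have "norm (inf \<bar>y n\<bar> u) \<le> norm (inf \<bar>z n\<bar> u)" for n
      using that y_le by (intro norm_mono_nonneg) (auto intro: le_infI1)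
    then show "\<forall>\<^sub>F n in sequentially. norm (norm (inf \<bar>y n\<bar> u)) \<le> norm (inf \<bar>z n\<bar> u)" by simp
  qed
  have freq_y: "\<exists>\<^sub>F n in sequentially. min \<epsilon> 1 \<le> norm (y n)"
    using freq0 y_large by (rule frequently_elim1)
  obtain r where r: "strict_mono r" "\<And>k. min \<epsilon> 1 \<le> norm (y (r k))"
    "(\<lambda>k. norm (inf \<bar>y (r k)\<bar> (4 ^ k *\<^sub>R (\<Sum>i<k. \<bar>y (r i)\<bar>)))) \<longlonglongrightarrow> 0"
    by (rule unbounded_norm_null_subsequence) (erule un_y, rule freq_y, rule that)
  define v where "v k = y (r k)" for k
  have v: "weakly_null v" unfolding weakly_null_def v_def
    using wn LIMSEQ_subseq_LIMSEQ[OF _ r(1)] by (fastforce simp: weakly_null_def o_def)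
  \<comment> \<open>The negative part of \<open>v k\<close> is the positive part of
    \<open>- v k\<close>, and almost disjointness depends on the moduli only.\<close>
  have "weakly_null (\<lambda>k. - v k)" unfolding weakly_null_def
  proof (intro allI impI)
    fix f :: "'a \<Rightarrow> real" assume f: "bounded_linear f"
    then have "(\<lambda>k. - f (v k)) \<longlonglongrightarrow> - 0" using v by (intro tendsto_minus) (simp add: weakly_null_def)
    then show "(\<lambda>k. f (- v k)) \<longlonglongrightarrow> 0" by (simp add: linear_simps(4)[OF f])
  qed
  note v this
  then have "weakly_null (\<lambda>k. pprt (v k))" "weakly_null (\<lambda>k. pprt (- v k))"
    using weakly_null_pprt[of v] weakly_null_pprt[of "\<lambda>k. - v k"] y1 r(3) by (simp_all add: v_def)
  then have "(\<lambda>k. norm (pprt (v k))) \<longlonglongrightarrow> 0" "(\<lambda>k. norm (pprt (- v k))) \<longlonglongrightarrow> 0"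
    using psp by (simp_all add: positive_Schur_property_def)
  then have "(\<lambda>k. norm (pprt (v k)) + norm (pprt (- v k))) \<longlonglongrightarrow> 0" by (rule tendsto_add_zero)
  moreover have "min \<epsilon> 1 \<le> norm (pprt (v k)) + norm (pprt (- v k))" for k
  proof -
    have "v k = pprt (v k) - pprt (- v k)" using prts[of "v k"] by (simp add: pprt_neg)
    then have "norm (v k) \<le> norm (pprt (v k)) + norm (pprt (- v k))" by (metis norm_triangle_ineq4)
    then show ?thesis using r(2)[of k] by (simp add: v_def)
  qed
  ultimately have "min \<epsilon> 1 \<le> 0" by (intro LIMSEQ_le_const) auto
  with \<open>0 < \<epsilon>\<close> show False by simp
qed

section \<open>Order continuity of the norm from the positive Schur property\<close>

text \<open>For each functional, splitting the indices by the sign of \<open>f (u k)\<close> bounds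
  the sum of the absolute values, with one bound \<open>B * K\<close> per sign. The series converges
  absolutely, so its terms tend to 0.\<close>

lemma weakly_null_of_bounded_partial_sums:
  fixes u :: "nat \<Rightarrow> 'a::real_normed_vector"
  assumes "\<And>A. finite A \<Longrightarrow> norm (sum u A) \<le> B"
  shows "weakly_null u"
  unfolding weakly_null_def
proof (intro allI impI)
  fix f :: "'a \<Rightarrow> real" assume "bounded_linear f"
  then interpret f: bounded_linear f .
  obtain K where K: "0 \<le> K" "\<And>x. norm (f x) \<le> norm x * K" using f.nonneg_bounded by blast
  have part: "\<bar>\<Sum>k\<in>A. f (u k)\<bar> \<le> B * K" if "finite A" for A
    using K(2)[of "sum u A"] mult_right_mono[OF assms[OF that] K(1)] by (simp add: f.sum)
  have "(\<Sum>k\<le>n. norm (f (u k))) \<le> 2 * (B * K)" for n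
  proof -
    let ?P = "{k. k \<le> n \<and> 0 \<le> f (u k)}" and ?N = "{k. k \<le> n \<and> \<not> 0 \<le> f (u k)}"
    have "(\<Sum>k\<le>n. norm (f (u k))) = (\<Sum>k\<in>?P. norm (f (u k))) + (\<Sum>k\<in>?N. norm (f (u k)))"
      by (subst sum.union_disjoint[symmetric]) (auto intro!: sum.cong)
    also have "\<dots> = (\<Sum>k\<in>?P. f (u k)) - (\<Sum>k\<in>?N. f (u k))"
      by (simp add: sum_negf[symmetric])
    also have "\<dots> \<le> 2 * (B * K)" using part[of ?P] part[of ?N] by simp
    finally show ?thesis .
  qed
  then have "summable (\<lambda>k. norm (f (u k)))" by (intro bounded_imp_summable[where B = "2 * (B * K)"]) auto
  then show "(\<lambda>n. f (u n)) \<longlonglongrightarrow> 0" using summable_LIMSEQ_zero tendsto_norm_zero_iff by blast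
qed

text \<open>By telescoping, all finite sums of the differences lie between 0 and \<open>d 0\<close>;
  the differences are therefore weakly null and positive.\<close>

lemma positive_Schur_decreasing_differences_null:
  fixes d :: "nat \<Rightarrow> 'a::banach_lattice"
  assumes psp: "positive_Schur_property TYPE('a)"
    and dec: "\<And>k. d (Suc k) \<le> d k" and pos: "\<And>k. 0 \<le> d k"
  shows "(\<lambda>k. norm (d k - d (Suc k))) \<longlonglongrightarrow> 0"
proof -
  have "norm (\<Sum>k\<in>A. d k - d (Suc k)) \<le> norm (d 0)" if A: "finite A" for A
  proof (rule norm_mono_nonneg)
    show "0 \<le> (\<Sum>k\<in>A. d k - d (Suc k))" using dec by (intro sum_nonneg) auto
    obtain n where n: "A \<subseteq> {..<n}" using A unfolding finite_nat_iff_bounded ..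
    have "(\<Sum>k\<in>A. d k - d (Suc k)) \<le> (\<Sum>k<n. d k - d (Suc k))"
      using n dec by (intro sum_mono2) auto
    also have "\<dots> = d 0 - d n" by (rule sum_lessThan_telescope')
    also have "\<dots> \<le> d 0" using pos by simp
    finally show "(\<Sum>k\<in>A. d k - d (Suc k)) \<le> d 0" .
  qed
  then have "weakly_null (\<lambda>k. d k - d (Suc k))" by (rule weakly_null_of_bounded_partial_sums)
  then show ?thesis using psp dec by (simp add: positive_Schur_property_def)
qed

lemma positive_Schur_order_continuous_norm:
  fixes D :: "'a::banach_lattice set"
  assumes psp: "positive_Schur_property TYPE('a)" and D: "decreases_to_zero D" and "0 < \<epsilon>"
  shows "\<exists>d\<in>D. norm d < \<epsilon>"
proof -
  have ne: "D \<noteq> {}" and dir: "\<And>a b. a \<in> D \<Longrightarrow> b \<in> D \<Longrightarrow> \<exists>c\<in>D. c \<le> a \<and> c \<le> b"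
    and pos: "\<And>d. d \<in> D \<Longrightarrow> 0 \<le> d" and glb: "\<And>z. (\<And>d. d \<in> D \<Longrightarrow> z \<le> d) \<Longrightarrow> z \<le> 0"
    using D by (auto simp: decreases_to_zero_def)
  \<comment> \<open>\<open>D\<close>, as a decreasing net, is norm Cauchy; its limit is then its infimum.\<close>
  have cauchy: "\<exists>d\<in>D. \<forall>d'\<in>D. d' \<le> d \<longrightarrow> norm (d - d') < e" if "0 < e" for e
  proof (rule ccontr)
    assume "\<not> ?thesis"
    then have *: "\<And>d. d \<in> D \<Longrightarrow> \<exists>d'\<in>D. d' \<le> d \<and> e \<le> norm (d - d')" by (auto simp: not_less)
    have "\<exists>d. \<forall>k::nat. d k \<in> D \<and> (d (Suc k) \<le> d k \<and> e \<le> norm (d k - d (Suc k)))"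
      by (rule dependent_nat_choice) (use ne * in auto)
    then obtain d where d: "\<And>k::nat. d k \<in> D" "\<And>k. d (Suc k) \<le> d k" "\<And>k. e \<le> norm (d k - d (Suc k))"
      by blast
    from positive_Schur_decreasing_differences_null[of d] psp d pos
    have "(\<lambda>k. norm (d k - d (Suc k))) \<longlonglongrightarrow> 0" by blast
    then have "e \<le> 0" using d(3) by (intro LIMSEQ_le_const) auto
    with that show False by simp
  qed
  \<comment> \<open>The Cauchy estimate passes to smaller elements of \<open>D\<close>, so it can be
    arranged below any given \<open>a\<close>; this makes the chosen sequence decreasing.\<close>
  have near: "\<exists>c\<in>D. c \<le> a \<and> (\<forall>d'\<in>D. d' \<le> c \<longrightarrow> norm (c - d') < (1/2) ^ k)" if a: "a \<in> D" for a and k :: nat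
  proof -
    obtain d where d: "d \<in> D" "\<And>d'. d' \<in> D \<Longrightarrow> d' \<le> d \<Longrightarrow> norm (d - d') < (1/2) ^ k"
      using cauchy[of "(1/2) ^ k"] by auto
    obtain c where c: "c \<in> D" "c \<le> a" "c \<le> d" using dir[OF a d(1)] by blast
    have "norm (c - d') < (1/2) ^ k" if "d' \<in> D" "d' \<le> c" for d'
    proof -
      have "norm (c - d') \<le> norm (d - d')" using that c by (intro norm_mono_nonneg) auto
      also have "\<dots> < (1/2) ^ k" using that c by (intro d(2)) auto
      finally show ?thesis .
    qed
    with c show ?thesis by blast
  qed
  have "\<exists>d. \<forall>k::nat. (d k \<in> D \<and> (\<forall>d'\<in>D. d' \<le> d k \<longrightarrow> norm (d k - d') < (1/2) ^ k)) \<and> d (Suc k) \<le> d k"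
    by (rule dependent_nat_choice) (use ne near in blast)+
  then obtain d where d: "\<And>k::nat. d k \<in> D" "\<And>k d'. d' \<in> D \<Longrightarrow> d' \<le> d k \<Longrightarrow> norm (d k - d') < (1/2) ^ k"
    "\<And>k. d (Suc k) \<le> d k" by blast
  have half: "(\<lambda>k. (1/2 :: real) ^ k) \<longlonglongrightarrow> 0" by (rule LIMSEQ_power_zero) simp
  have anti: "d n \<le> d m" if "m \<le> n" for m n using lift_Suc_antimono_le[of d] d(3) that by blast
  have "Cauchy d"
  proof (rule metric_CauchyI)
    fix e :: real assume "0 < e"
    then obtain N where N: "(1/2 :: real) ^ N < e / 2"
      using real_arch_pow_inv[of "e / 2" "1/2"] by auto
    have "dist (d N) (d m) < e / 2" if "N \<le> m" for m
      using d(2)[OF d(1) anti[OF that]] N by (simp add: dist_norm)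
    then have "dist (d m) (d n) < e" if "N \<le> m" "N \<le> n" for m n
      using that dist_triangle_half_r by blast
    then show "\<exists>N. \<forall>m\<ge>N. \<forall>n\<ge>N. dist (d m) (d n) < e" by blast
  qed
  then obtain l where l: "d \<longlonglongrightarrow> l" using Cauchy_convergent convergent_def by blast
  have "l \<le> x" if "x \<in> D" for x
  proof -
    \<comment> \<open>Elements of \<open>D\<close> below \<open>d k\<close> are within
      \<open>2^-k\<close> of it in norm, so a sequence that also stays below \<open>x\<close> has
      the same limit \<open>l\<close>.\<close>
    have "\<exists>c. \<forall>k. c k \<in> D \<and> c k \<le> d k \<and> c k \<le> x" using dir[OF d(1) that] by metis
    then obtain c where c: "\<And>k. c k \<in> D" "\<And>k. c k \<le> d k" "\<And>k. c k \<le> x" by blast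
    have "(\<lambda>k. d k - c k) \<longlonglongrightarrow> 0"
      by (intro Lim_null_comparison[OF _ half] always_eventually allI less_imp_le d(2) c)
    from tendsto_diff[OF l this] have "c \<longlonglongrightarrow> l" by simp
    then show "l \<le> x" using tendsto_const c(3) by (rule tendsto_le_lattice)
  qed
  then have "l \<le> 0" by (rule glb)
  moreover have "0 \<le> l" using l d(1) pos by (blast intro: tendsto_nonneg_lattice)
  ultimately have "(\<lambda>k. norm (d k)) \<longlonglongrightarrow> 0" using l tendsto_norm_zero by fastforce
  then have "\<forall>\<^sub>F k in sequentially. norm (d k) < \<epsilon>" using \<open>0 < \<epsilon>\<close> by (rule order_tendstoD(2))
  then show ?thesis using d(1) eventually_happens by fastforce
qed

text \<open>Order continuity of the norm supplies elements of arbitrarily small norm in the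
  dominating set, and each of them eventually dominates
  \<open>inf \<bar>z n\<bar> u\<close>.\<close>

lemma positive_Schur_uo_convergent_imp_un_null:
  fixes z :: "'i \<Rightarrow> 'a::banach_lattice"
  assumes psp: "positive_Schur_property TYPE('a)" and z: "uo_convergent_to z 0 F" and "0 \<le> u"
  shows "((\<lambda>n. norm (inf \<bar>z n\<bar> u)) \<longlongrightarrow> 0) F"
proof -
  obtain D where D: "decreases_to_zero D" "\<And>d. d \<in> D \<Longrightarrow> \<forall>\<^sub>F n in F. abs (inf \<bar>z n\<bar> u) \<le> d"
    using z \<open>0 \<le> u\<close> unfolding uo_convergent_to_def order_convergent_to_def by auto
  show ?thesis
  proof (rule tendstoI)
    fix e :: real assume "0 < e"
    then obtain d where d: "d \<in> D" "norm d < e" using positive_Schur_order_continuous_norm[OF psp D(1)] by blast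
    from D(2)[OF d(1)] show "\<forall>\<^sub>F n in F. dist (norm (inf \<bar>z n\<bar> u)) 0 < e"
    proof eventually_elim
      case (elim n)
      then have "norm (inf \<bar>z n\<bar> u) \<le> norm d"
        by (intro norm_lattice order_trans[OF elim abs_ge_self])
      with d(2) show ?case by simp
    qed
  qed
qed

section \<open>Passage to demi Dunford-Pettis and Dunford-Pettis operators\<close>

text \<open>Write \<open>x n\<close> as the sum of \<open>x n - T (x n)\<close> and
  \<open>T (x n)\<close>; both summands are norm null.\<close>

lemma Dunford_Pettis_imp_demi_Dunford_Pettis:
  fixes T :: "'a::banach \<Rightarrow> 'a"
  assumes "Dunford_Pettis T"
  shows "demi_Dunford_Pettis T"
  unfolding demi_Dunford_Pettis_def
proof (intro conjI allI impI)
  show "bounded_linear T" using assms by (simp add: Dunford_Pettis_def)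
  fix x :: "nat \<Rightarrow> 'a"
  assume "weakly_null x" and diff: "(\<lambda>n. norm (x n - T (x n))) \<longlonglongrightarrow> 0"
  then have "(\<lambda>n. norm (T (x n))) \<longlonglongrightarrow> 0" using assms by (simp add: Dunford_Pettis_def)
  from tendsto_add[OF diff[unfolded tendsto_norm_zero_iff] this[unfolded tendsto_norm_zero_iff]]
  show "(\<lambda>n. norm (x n)) \<longlonglongrightarrow> 0" by (simp add: tendsto_norm_zero_iff)
qed

theorem proposition3p2:
  assumes "positive_Schur_property TYPE('a::banach_lattice)"
  shows "(\<forall>T :: 'a \<Rightarrow> 'a. demi_Dunford_Pettis T \<longrightarrow> uo_demi_Dunford_Pettis T) \<and>
         (\<forall>T :: 'a \<Rightarrow> 'a. Dunford_Pettis T \<longrightarrow> uo_demi_Dunford_Pettis T)"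
proof -
  have "uo_demi_Dunford_Pettis T" if T: "demi_Dunford_Pettis T" for T :: "'a \<Rightarrow> 'a"
    unfolding uo_demi_Dunford_Pettis_def
  proof (intro conjI allI impI)
    show bl: "bounded_linear T" using T by (simp add: demi_Dunford_Pettis_def)
    fix x :: "nat \<Rightarrow> 'a"
    assume x: "weakly_null x" and uo: "uo_convergent_to (\<lambda>n. x n - T (x n)) 0 sequentially"
    have "weakly_null (\<lambda>n. x n - T (x n))" unfolding weakly_null_def
    proof (intro allI impI)
      fix f :: "'a \<Rightarrow> real" assume "bounded_linear f"
      then have "bounded_linear (\<lambda>y. f (y - T y))"
        by (rule bounded_linear_compose) (intro bounded_linear_sub bounded_linear_ident bl)
      with x show "(\<lambda>n. f (x n - T (x n))) \<longlonglongrightarrow> 0" unfolding weakly_null_def by blast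
    qed
    then have "(\<lambda>n. norm (x n - T (x n))) \<longlonglongrightarrow> 0"
      using positive_Schur_uo_convergent_imp_un_null[OF assms uo]
      by (rule weakly_null_un_null_imp_norm_null[OF assms])
    with T x show "(\<lambda>n. norm (x n)) \<longlonglongrightarrow> 0" by (simp add: demi_Dunford_Pettis_def)
  qed
  then show ?thesis using Dunford_Pettis_imp_demi_Dunford_Pettis by blast
qed

end
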